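(* Let $\mathcal{A}$ be the fourth order four dimensional Hankel tensor with generating vector $\mathbf{v}=(v_0,v_1,\ldots,v_{12})^\top\in\mathbb{R}^{13}$. If $\mathcal{A}$ is a PSD (or positive definite, or SOS, or strong) Hankel tensor, then $$v_i\ge 0\quad\text{for } i=0,4,8,12,$$ $$v_i+6v_{i+2}+v_{i+4}\ge 4|v_{i+1}+v_{i+3}|\quad\text{for } i=0,4,8,$$ $$v_i+6v_{i+4}+v_{i+8}\ge 4|v_{i+2}+v_{i+6}|\quad\text{for } i=0,4,$$ and $$v_0+6v_6+v_{12}\ge 4|v_3+v_9|.$$
   Context: A fourth order four dimensional Hankel tensor $\mathcal{A}=(a_{i_1i_2i_3i_4})$ with generating vector $\mathbf{v}=(v_0,\ldots,v_{12})^\top\in\mathbb{R}^{13}$ is defined by $a_{i_1i_2i_3i_4}=v_{i_1+i_2+i_3+i_4-4}$ for $i_1,i_2,i_3,i_4\in\{1,2,3,4\}$. Its associated polynomial is $f(\mathbf{x})=\sum_{i_1,i_2,i_3,i_4=1}^4 v_{i_1+i_2+i_3+i_4-4}\,x_{i_1}x_{i_2}x_{i_3}x_{i_4}$, $\mathbf{x}\in\mathbb{R}^4$. $\mathcal{A}$ is PSD if $f(\mathbf{x})\ge 0$ for all $\mathbf{x}\in\mathbb{R}^4$; positive definite if $f(\mathbf{x})>0$ for all $\mathbf{x}\ne 0$; SOS if $f$ is a sum of squares of real quadratic homogeneous polynomials; strong if the $7\times 7$ Hankel matrix $(v_{i+j})_{i,j=0}^{6}$ is positive semi-definite. *)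

theory Defs
  imports Complex_Main "Jordan_Normal_Form.Matrix"
begin

(* Tensor indices run over {1..4}; entries outside that range are irrelevant.
   Vectors are 0-based, so the i-th coordinate of x is x $ (i - 1). *)
type_synonym tensor4 = "nat \<Rightarrow> nat \<Rightarrow> nat \<Rightarrow> nat \<Rightarrow> real"

definition hankel_tensor :: "real vec \<Rightarrow> tensor4" where
  "hankel_tensor v i1 i2 i3 i4 = v $ (i1 + i2 + i3 + i4 - 4)"

definition tensor_poly :: "tensor4 \<Rightarrow> real vec \<Rightarrow> real" where
  "tensor_poly A x = (\<Sum>i1 = 1..4. \<Sum>i2 = 1..4. \<Sum>i3 = 1..4. \<Sum>i4 = 1..4.
     A i1 i2 i3 i4 * x $ (i1 - 1) * x $ (i2 - 1) * x $ (i3 - 1) * x $ (i4 - 1))"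

definition psd_tensor :: "tensor4 \<Rightarrow> bool" where
  "psd_tensor A \<longleftrightarrow> (\<forall>x \<in> carrier_vec 4. tensor_poly A x \<ge> 0)"

definition pd_tensor :: "tensor4 \<Rightarrow> bool" where
  "pd_tensor A \<longleftrightarrow> (\<forall>x \<in> carrier_vec 4. x \<noteq> 0\<^sub>v 4 \<longrightarrow> tensor_poly A x > 0)"

(* Polynomials are represented by their functions on R^4, which determine them
   since R is infinite. *)
definition quadratic_form4 :: "(real vec \<Rightarrow> real) \<Rightarrow> bool" where
  "quadratic_form4 q \<longleftrightarrow> (\<exists>c :: nat \<Rightarrow> nat \<Rightarrow> real. \<forall>x \<in> carrier_vec 4.
     q x = (\<Sum>i<4. \<Sum>j<4. c i j * x $ i * x $ j))"

definition sos_tensor :: "tensor4 \<Rightarrow> bool" where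
  "sos_tensor A \<longleftrightarrow> (\<exists>(r :: nat) q. (\<forall>k<r. quadratic_form4 (q k)) \<and>
     (\<forall>x \<in> carrier_vec 4. tensor_poly A x = (\<Sum>k<r. (q k x)\<^sup>2)))"

definition psd_matrix :: "nat \<Rightarrow> real mat \<Rightarrow> bool" where
  "psd_matrix n M \<longleftrightarrow> M \<in> carrier_mat n n \<and> transpose_mat M = M \<and>
     (\<forall>y \<in> carrier_vec n. y \<bullet> (M *\<^sub>v y) \<ge> 0)"

definition hankel_matrix7 :: "real vec \<Rightarrow> real mat" where
  "hankel_matrix7 v = mat 7 7 (\<lambda>(i, j). v $ (i + j))"

(* Stated on the generating vector: every v_k with k \<le> 12 occurs as an entry of
   hankel_tensor v, so the tensor determines v. *)
definition strong_hankel :: "real vec \<Rightarrow> bool" where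
  "strong_hankel v \<longleftrightarrow> psd_matrix 7 (hankel_matrix7 v)"

end

(* Evaluating the associated polynomial at the binary vectors e_p + t e_q with t = 1 and t = -1
   yields v_{4p} + 6 v_{2p+2q} + v_{4q} + 4 t (v_{3p+q} + v_{p+3q}) >= 0; the six pairs p < q give
   the six mixed inequalities, and t = 0 gives v_{4p} >= 0. A strong Hankel tensor is PSD because the polynomial at x is the
   Hankel quadratic form at the self-convolution of x. *)
theory Submission
  imports Defs
begin

text \<open>With 0-based indices the offset 4 disappears. Each level of the nesting pairs
  \<open>x\<close> with a function of one index, so an identity for a single such pairing can be
  rewritten at every level.\<close>

lemma tensor_poly_hankel_nested:
  "tensor_poly (hankel_tensor v) x =
    (\<Sum>i<4. x $ i * (\<Sum>j<4. x $ j * (\<Sum>k<4. x $ k * (\<Sum>l<4. x $ l * v $ (i + j + k + l)))))"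
proof -
  have shift: "(\<Sum>i=1..4. g i) = (\<Sum>i<4. g (Suc i))" for g :: "nat \<Rightarrow> real"
    by (simp add: atLeastAtMostSuc_conv numeral_eq_Suc)
  show ?thesis
    unfolding tensor_poly_def hankel_tensor_def shift sum_distrib_left
    by (intro sum.cong refl) (simp add: algebra_simps)
qed

text \<open>An entry depends only on the sum of its indices, so the words of length four in
  \<open>p\<close> and \<open>q\<close> with m letters \<open>q\<close> share one entry; there are
  binomial(4, m) of them, each with weight \<open>t ^ m\<close>.\<close>

lemma tensor_poly_hankel_binary:
  fixes t :: real
  assumes "p < 4" "q < 4" "p \<noteq> q"
  shows "tensor_poly (hankel_tensor v) (vec 4 (\<lambda>i. if i = p then 1 else if i = q then t else 0)) =
    v $ (4 * p) + 4 * t * v $ (3 * p + q) + 6 * t\<^sup>2 * v $ (2 * p + 2 * q) + 4 * t ^ 3 * v $ (p + 3 * q)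
      + t ^ 4 * v $ (4 * q)" (is "tensor_poly _ ?x = _")
proof -
  have supp: "(\<Sum>i<4. ?x $ i * g i) = g p + t * g q" for g
  proof -
    have "(\<Sum>i<4. ?x $ i * g i) = (\<Sum>i\<in>{p, q}. ?x $ i * g i)"
      using assms by (intro sum.mono_neutral_right) auto
    then show ?thesis using assms by simp
  qed
  \<comment> \<open>All 16 words, brought to one normal form for each number of letters
    \<open>q\<close>.\<close>
  have index: "p + p + p + p = 4 * p" "p + p + p + q = 3 * p + q" "p + p + q + p = 3 * p + q"
    "p + q + p + p = 3 * p + q" "q + p + p + p = 3 * p + q" "p + p + q + q = 2 * p + 2 * q"
    "p + q + p + q = 2 * p + 2 * q" "p + q + q + p = 2 * p + 2 * q" "q + p + p + q = 2 * p + 2 * q"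
    "q + p + q + p = 2 * p + 2 * q" "q + q + p + p = 2 * p + 2 * q" "p + q + q + q = p + 3 * q"
    "q + p + q + q = p + 3 * q" "q + q + p + q = p + 3 * q" "q + q + q + p = p + 3 * q"
    "q + q + q + q = 4 * q"
    by simp_all
  show ?thesis
    unfolding tensor_poly_hankel_nested supp index
    by (simp add: algebra_simps power2_eq_square power3_eq_cube power4_eq_xxxx)
qed

lemma psd_hankel_binary:
  assumes "psd_tensor (hankel_tensor v)" "p < 4" "q < 4" "p \<noteq> q"
  shows "v $ (4 * p) \<ge> 0" (is ?vertex)
    and "v $ (4 * p) + 6 * v $ (2 * p + 2 * q) + v $ (4 * q) \<ge> 4 * \<bar>v $ (3 * p + q) + v $ (p + 3 * q)\<bar>"
      (is ?edge)
proof -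
  have nonneg: "v $ (4 * p) + 4 * t * v $ (3 * p + q) + 6 * t\<^sup>2 * v $ (2 * p + 2 * q)
      + 4 * t ^ 3 * v $ (p + 3 * q) + t ^ 4 * v $ (4 * q) \<ge> 0" for t
    using assms(1) unfolding psd_tensor_def tensor_poly_hankel_binary[OF assms(2-4), symmetric] by simp
  show ?vertex using nonneg[of 0] by simp
  show ?edge using nonneg[of 1] nonneg[of "-1"] by (simp add: abs_if)
qed

lemma pd_imp_psd_tensor:
  assumes "pd_tensor A"
  shows "psd_tensor A"
  unfolding psd_tensor_def
proof
  fix x :: "real vec"
  assume x: "x \<in> carrier_vec 4"
  \<comment> \<open>Positive definiteness says nothing about the zero vector.\<close>
  have "tensor_poly A (0\<^sub>v 4) = 0"
    unfolding tensor_poly_def by (intro sum.neutral ballI) auto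
  with assms x show "tensor_poly A x \<ge> 0"
    unfolding pd_tensor_def by (cases "x = 0\<^sub>v 4") (auto intro: less_imp_le)
qed

lemma sos_imp_psd_tensor: "sos_tensor A \<Longrightarrow> psd_tensor A"
  unfolding sos_tensor_def psd_tensor_def by (auto simp: sum_nonneg)

lemma strong_imp_psd_tensor:
  assumes "strong_hankel v"
  shows "psd_tensor (hankel_tensor v)"
  unfolding psd_tensor_def
proof
  fix x :: "real vec"
  assume "x \<in> carrier_vec 4"
  \<comment> \<open>\<open>y $ a\<close> is the coefficient of z^a in the square of the cubic with
    coefficients \<open>x\<close>; the square has degree at most 6, hence length 7.\<close>
  define y where "y = vec 7 (\<lambda>a. \<Sum>i<4. \<Sum>j<4. if i + j = a then x $ i * x $ j else 0)"
  have conv: "(\<Sum>a<7. y $ a * g a) = (\<Sum>i<4. x $ i * (\<Sum>j<4. x $ j * g (i + j)))" for g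
  proof -
    have "(\<Sum>a<7. y $ a * g a) = (\<Sum>a<7. \<Sum>i<4. \<Sum>j<4. if i + j = a then x $ i * x $ j * g a else 0)"
      unfolding y_def by (auto simp: sum_distrib_right intro!: sum.cong)
    \<comment> \<open>With the sum over \<open>a\<close> innermost, only \<open>a = i + j\<close>
      survives, and it is in range since i + j \<le> 6.\<close>
    also have "\<dots> = (\<Sum>i<4. \<Sum>j<4. \<Sum>a<7. if i + j = a then x $ i * x $ j * g a else 0)"
      by (rule trans[OF sum.swap]) (intro sum.cong refl sum.swap)
    also have "\<dots> = (\<Sum>i<4. x $ i * (\<Sum>j<4. x $ j * g (i + j)))"
      by (auto simp: sum_distrib_left mult.assoc intro!: sum.cong)
    finally show ?thesis .
  qed
  \<comment> \<open>\<open>conv\<close> unfolds both sums on the right, turning \<open>a\<close>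
    into \<open>i + j\<close> and \<open>b\<close> into \<open>k + l\<close>.\<close>
  have "tensor_poly (hankel_tensor v) x = (\<Sum>a<7. y $ a * (\<Sum>b<7. y $ b * v $ (a + b)))"
    unfolding tensor_poly_hankel_nested conv by (simp add: add.assoc)
  also have "\<dots> = y \<bullet> (hankel_matrix7 v *\<^sub>v y)"
    by (auto simp: scalar_prod_def hankel_matrix7_def y_def lessThan_atLeast0 mult.commute
        intro!: sum.cong)
  also have "\<dots> \<ge> 0"
    using assms unfolding strong_hankel_def psd_matrix_def by (simp add: y_def)
  finally show "tensor_poly (hankel_tensor v) x \<ge> 0" .
qed

theorem theorem1:
  fixes v :: "real vec"
  assumes "v \<in> carrier_vec 13"
    and "psd_tensor (hankel_tensor v) \<or> pd_tensor (hankel_tensor v) \<or>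
         sos_tensor (hankel_tensor v) \<or> strong_hankel v"
  shows "(\<forall>i \<in> {0, 4, 8, 12}. v $ i \<ge> 0) \<and>
    (\<forall>i \<in> {0, 4, 8}. v $ i + 6 * v $ (i + 2) + v $ (i + 4) \<ge> 4 * \<bar>v $ (i + 1) + v $ (i + 3)\<bar>) \<and>
    (\<forall>i \<in> {0, 4}. v $ i + 6 * v $ (i + 4) + v $ (i + 8) \<ge> 4 * \<bar>v $ (i + 2) + v $ (i + 6)\<bar>) \<and>
    v $ 0 + 6 * v $ 6 + v $ 12 \<ge> 4 * \<bar>v $ 3 + v $ 9\<bar>"
proof -
  have "psd_tensor (hankel_tensor v)"
    using assms(2) pd_imp_psd_tensor sos_imp_psd_tensor strong_imp_psd_tensor by blast
  note binary = psd_hankel_binary[OF this]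
  show ?thesis
    \<comment> \<open>For the vertex bounds any second index different from \<open>p\<close> serves.
      The mixed bounds are grouped by q - p = 1, 2, 3, with i = 4p.\<close>
    using binary(1)[of 0 1] binary(1)[of 1 0] binary(1)[of 2 0] binary(1)[of 3 0]
      binary(2)[of 0 1] binary(2)[of 1 2] binary(2)[of 2 3]
      binary(2)[of 0 2] binary(2)[of 1 3] binary(2)[of 0 3]
    by simp
qed

end
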